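(* Let $n\ge 2$ be an integer. The pseudovariety of ordered monoids $[\![1\le x^n]\!]$ is not contained in the Mal'cev product $\mathsf A\circ_m[\![x^n=1]\!]$ (i.e. some finite ordered monoid satisfying $1\le x^n$ has underlying monoid not in $\mathsf A\circ_m[\![x^n=1]\!]$). In particular, $[\![1\le x^n]\!]$ is contained in neither $\mathsf J\circ_m[\![x^n=1]\!]$ nor $\mathsf J*[\![x^n=1]\!]$.
   Context: An ordered monoid is a monoid with a partial order compatible with multiplication. $[\![1\le x^n]\!]$ is the class of all finite ordered monoids $M$ with $1\le s^n$ for all $s\in M$. $[\![x^n=1]\!]$ is the pseudovariety of finite monoids (necessarily groups) satisfying $x^n=1$. A pseudovariety of monoids is identified with the pseudovariety of ordered monoids consisting of all its members under all compatible orders. $\mathsf A$ is the pseudovariety of all finite aperiodic monoids and $\mathsf J$ that of all finite $\mathcal J$-trivial monoids; the same symbols denote the pseudovarieties of semigroups they generate (finite aperiodic, resp. $\mathcal J$-trivial, semigroups). For a pseudovariety $\mathsf V$ of semigroups and a pseudovariety $\mathsf W$ of monoids, the Mal'cev product $\mathsf V\circ_m\mathsf W$ consists of all finite monoids $M$ for which there are $N\in\mathsf W$ and a relational morphism $\mu:M\to N$ (a submonoid $\mu$ of $M\times N$ projecting onto $M$) such that $\mu^{-1}(e)\in\mathsf V$ for every idempotent $e\in N$. For pseudovarieties of monoids $\mathsf V,\mathsf W$, $\mathsf V*\mathsf W$ is the pseudovariety of monoids generated by all semidirect products $S*T$ with $S\in\mathsf V$, $T\in\mathsf W$, where $T$ acts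 on the left of $S$ by monoid endomorphisms with $1_T$ acting as the identity. *)

theory Defs
  imports "HOL-Algebra.Group"
begin

text \<open>
  Every finite (ordered) monoid or semigroup is isomorphic to one whose carrier is a finite set of
  natural numbers. A class of finite structures is therefore represented by the set of its members
  with carrier included in \<open>nat\<close>; isomorphic copies are used where a construction leaves \<open>nat\<close>.
\<close>

subsection \<open>Finite monoids and finite semigroups\<close>

definition finite_monoids :: "nat monoid set" where
  "finite_monoids = {M. monoid M \<and> finite (carrier M)}"

definition monoids_pow_eq_one :: "nat \<Rightarrow> nat monoid set" where
  "monoids_pow_eq_one n =
     {M \<in> finite_monoids. \<forall>x\<in>carrier M. x [^]\<^bsub>M\<^esub> n = \<one>\<^bsub>M\<^esub>}"

record 'a sgrp = "'a partial_object" +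
  sg_mult :: "['a, 'a] \<Rightarrow> 'a" (infixl \<open>\<odot>\<index>\<close> 70)

definition sgrp_of :: "('a, 'b) monoid_scheme \<Rightarrow> 'a set \<Rightarrow> 'a sgrp" where
  "sgrp_of M X = \<lparr>carrier = X, sg_mult = mult M\<rparr>"

text \<open>
  The empty semigroup is admitted, because the preimage of an idempotent under a relational morphism
  may be empty.
\<close>

definition finite_semigroups :: "nat sgrp set" where
  "finite_semigroups = {S. finite (carrier S)
     \<and> (\<forall>x\<in>carrier S. \<forall>y\<in>carrier S. x \<odot>\<^bsub>S\<^esub> y \<in> carrier S)
     \<and> (\<forall>x\<in>carrier S. \<forall>y\<in>carrier S. \<forall>z\<in>carrier S.
          (x \<odot>\<^bsub>S\<^esub> y) \<odot>\<^bsub>S\<^esub> z = x \<odot>\<^bsub>S\<^esub> (y \<odot>\<^bsub>S\<^esub> z))}"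

text \<open>The value is the \<open>(k + 1)\<close>-st power of \<open>x\<close>, since a semigroup has no \<open>0\<close>-th power.\<close>

definition sg_pow_Suc :: "'a sgrp \<Rightarrow> 'a \<Rightarrow> nat \<Rightarrow> 'a" where
  "sg_pow_Suc S x k = ((\<lambda>y. y \<odot>\<^bsub>S\<^esub> x) ^^ k) x"

definition aperiodic_semigroups :: "nat sgrp set" where
  "aperiodic_semigroups = {S \<in> finite_semigroups.
     \<forall>x\<in>carrier S. \<exists>k. sg_pow_Suc S x (Suc k) = sg_pow_Suc S x k}"

text \<open>The ideal \<open>S\<^sup>1 x S\<^sup>1\<close>, where \<open>S\<^sup>1\<close> is \<open>S\<close> with an identity adjoined.\<close>

definition principal_ideal :: "'a sgrp \<Rightarrow> 'a \<Rightarrow> 'a set" where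
  "principal_ideal S x = {x}
     \<union> {a \<odot>\<^bsub>S\<^esub> x | a. a \<in> carrier S}
     \<union> {x \<odot>\<^bsub>S\<^esub> b | b. b \<in> carrier S}
     \<union> {(a \<odot>\<^bsub>S\<^esub> x) \<odot>\<^bsub>S\<^esub> b | a b. a \<in> carrier S \<and> b \<in> carrier S}"

definition green_J :: "'a sgrp \<Rightarrow> ('a \<times> 'a) set" where
  "green_J S = {(x, y). x \<in> carrier S \<and> y \<in> carrier S
     \<and> principal_ideal S x = principal_ideal S y}"

definition J_trivial_semigroups :: "nat sgrp set" where
  "J_trivial_semigroups = {S \<in> finite_semigroups. green_J S \<subseteq> Id}"

definition J_trivial_monoids :: "nat monoid set" where
  "J_trivial_monoids = {M \<in> finite_monoids. sgrp_of M (carrier M) \<in> J_trivial_semigroups}"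


subsection \<open>Mal'cev products\<close>

definition relational_morphism :: "nat monoid \<Rightarrow> nat monoid \<Rightarrow> (nat \<times> nat) set \<Rightarrow> bool" where
  "relational_morphism M N \<mu> \<longleftrightarrow> submonoid \<mu> (M \<times>\<times> N) \<and> fst ` \<mu> = carrier M"

definition malcev_product :: "nat sgrp set \<Rightarrow> nat monoid set \<Rightarrow> nat monoid set"
    (infixr \<open>\<circ>\<^sub>M\<close> 70) where
  "V \<circ>\<^sub>M W = {M \<in> finite_monoids. \<exists>N\<in>W. \<exists>\<mu>. relational_morphism M N \<mu>
     \<and> (\<forall>e\<in>carrier N. e \<otimes>\<^bsub>N\<^esub> e = e \<longrightarrow> sgrp_of M {s. (s, e) \<in> \<mu>} \<in> V)}"


subsection \<open>Generated pseudovarieties and semidirect products\<close>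

text \<open>
  Surjective homomorphisms of monoids preserve the identity, so closure under \<open>epi\<close> is closure under
  quotients, and in particular under isomorphism. The one-element monoids are the empty products.
\<close>

definition monoid_pseudovariety :: "nat monoid set \<Rightarrow> bool" where
  "monoid_pseudovariety V \<longleftrightarrow> V \<subseteq> finite_monoids
     \<and> (\<forall>M\<in>V. \<forall>H. submonoid H M \<longrightarrow> M\<lparr>carrier := H\<rparr> \<in> V)
     \<and> (\<forall>M\<in>V. \<forall>N\<in>finite_monoids. epi M N \<noteq> {} \<longrightarrow> N \<in> V)
     \<and> (\<forall>M\<in>finite_monoids. card (carrier M) = 1 \<longrightarrow> M \<in> V)
     \<and> (\<forall>M\<in>V. \<forall>N\<in>V. \<forall>P\<in>finite_monoids. P \<cong> M \<times>\<times> N \<longrightarrow> P \<in> V)"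

definition generated_pseudovariety :: "nat monoid set \<Rightarrow> nat monoid set" where
  "generated_pseudovariety C = \<Inter>{V. monoid_pseudovariety V \<and> C \<subseteq> V}"

definition left_action :: "nat monoid \<Rightarrow> nat monoid \<Rightarrow> (nat \<Rightarrow> nat \<Rightarrow> nat) \<Rightarrow> bool" where
  "left_action T S \<alpha> \<longleftrightarrow>
     (\<forall>t\<in>carrier T. \<alpha> t \<in> hom S S \<and> \<alpha> t \<one>\<^bsub>S\<^esub> = \<one>\<^bsub>S\<^esub>)
     \<and> (\<forall>t\<in>carrier T. \<forall>u\<in>carrier T. \<forall>s\<in>carrier S. \<alpha> (t \<otimes>\<^bsub>T\<^esub> u) s = \<alpha> t (\<alpha> u s))
     \<and> (\<forall>s\<in>carrier S. \<alpha> \<one>\<^bsub>T\<^esub> s = s)"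

definition semidirect :: "nat monoid \<Rightarrow> nat monoid \<Rightarrow> (nat \<Rightarrow> nat \<Rightarrow> nat) \<Rightarrow> (nat \<times> nat) monoid" where
  "semidirect S T \<alpha> =
     \<lparr>carrier = carrier S \<times> carrier T,
      mult = (\<lambda>(s, t) (s', t'). (s \<otimes>\<^bsub>S\<^esub> \<alpha> t s', t \<otimes>\<^bsub>T\<^esub> t')),
      one = (\<one>\<^bsub>S\<^esub>, \<one>\<^bsub>T\<^esub>)\<rparr>"

definition semidirect_product :: "nat monoid set \<Rightarrow> nat monoid set \<Rightarrow> nat monoid set"
    (infixr \<open>\<^bold>*\<close> 70) where
  "V \<^bold>* W = generated_pseudovariety
     {M \<in> finite_monoids. \<exists>S\<in>V. \<exists>T\<in>W. \<exists>\<alpha>. left_action T S \<alpha> \<and> M \<cong> semidirect S T \<alpha>}"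

lemma semidirect_monoid:
  assumes "monoid S" "monoid T" "left_action T S \<alpha>"
  shows "monoid (semidirect S T \<alpha>)"
proof -
  interpret S: monoid S by fact
  interpret T: monoid T by fact
  have hom: "\<alpha> t s \<in> carrier S" "\<alpha> t (s \<otimes>\<^bsub>S\<^esub> s') = \<alpha> t s \<otimes>\<^bsub>S\<^esub> \<alpha> t s'"
    if "t \<in> carrier T" "s \<in> carrier S" "s' \<in> carrier S" for t s s'
    using assms(3) that by (auto simp: left_action_def hom_def)
  show ?thesis
    using assms(3) hom
    by (intro monoidI) (auto simp: semidirect_def left_action_def S.m_assoc T.m_assoc)
qed

lemma monoid_pseudovariety_finite_monoids: "monoid_pseudovariety finite_monoids"
  by (auto simp: monoid_pseudovariety_def finite_monoids_def
      intro: submonoid.submonoid_is_monoid finite_subset[OF submonoid.subset])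


subsection \<open>Ordered monoids\<close>

record 'a ordered_monoid = "'a monoid" +
  ord_rel :: "('a \<times> 'a) set"

definition finite_ordered_monoids :: "nat ordered_monoid set" where
  "finite_ordered_monoids = {M. monoid M \<and> finite (carrier M)
     \<and> partial_order_on (carrier M) (ord_rel M)
     \<and> (\<forall>x y. (x, y) \<in> ord_rel M \<longrightarrow> (\<forall>z\<in>carrier M.
          (z \<otimes>\<^bsub>M\<^esub> x, z \<otimes>\<^bsub>M\<^esub> y) \<in> ord_rel M \<and> (x \<otimes>\<^bsub>M\<^esub> z, y \<otimes>\<^bsub>M\<^esub> z) \<in> ord_rel M))}"

definition ordered_monoids_one_le_pow :: "nat \<Rightarrow> nat ordered_monoid set" where
  "ordered_monoids_one_le_pow n =
     {M \<in> finite_ordered_monoids. \<forall>s\<in>carrier M. (\<one>\<^bsub>M\<^esub>, s [^]\<^bsub>M\<^esub> n) \<in> ord_rel M}"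

text \<open>The identification of a class of monoids with all compatible orders on its members.\<close>

definition all_orders :: "nat monoid set \<Rightarrow> nat ordered_monoid set" where
  "all_orders V = {M \<in> finite_ordered_monoids. monoid.truncate M \<in> V}"

end

theory Submission
  imports Defs
begin

text \<open>
  The word \<open>w = (c(ab)\<^sup>n\<^sup>-\<^sup>1)\<^sup>n\<^sup>-\<^sup>1 c b\<^sup>n\<^sup>-\<^sup>1 a\<^sup>n\<^sup>-\<^sup>1\<close> is trivial in every group of exponent \<open>n\<close>, because
  \<open>b\<^sup>n\<^sup>-\<^sup>1 a\<^sup>n\<^sup>-\<^sup>1 = (ab)\<^sup>-\<^sup>1 = (ab)\<^sup>n\<^sup>-\<^sup>1\<close> there. Hence all its values are aperiodic in the members of each of
  the three classes, and the monoids with this property form a pseudovariety. On the other hand, if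
  \<open>x\<^sup>n\<close> is a factor of the infinite word \<open>w\<^sup>\<infinity>\<close>, then \<open>|w|\<close> divides \<open>|x|\<close>. Let the
  letters act by partial injections on a cycle of length \<open>n|w|\<close> labelled by \<open>w\<^sup>n\<close>. Then \<open>x\<^sup>n\<close> acts as a
  restriction of the identity for every word \<open>x\<close>, so that the monoid of these partial injections,
  ordered by reverse inclusion, satisfies \<open>1 \<le> x\<^sup>n\<close>; but \<open>w\<close> acts as a rotation of order \<open>n\<close> and is
  not aperiodic.
\<close>

section \<open>A word that vanishes in groups of exponent n\<close>

text \<open>Natural exponents replace inverses, so the term can be evaluated in every monoid and
  commutes with homomorphisms that preserve the identity.\<close>

definition burnside_word :: "nat \<Rightarrow> ('a, 'b) monoid_scheme \<Rightarrow> 'a \<Rightarrow> 'a \<Rightarrow> 'a \<Rightarrow> 'a" where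
  "burnside_word n M a b c =
     (c \<otimes>\<^bsub>M\<^esub> (a \<otimes>\<^bsub>M\<^esub> b) [^]\<^bsub>M\<^esub> (n - 1)) [^]\<^bsub>M\<^esub> (n - 1)
       \<otimes>\<^bsub>M\<^esub> (c \<otimes>\<^bsub>M\<^esub> (b [^]\<^bsub>M\<^esub> (n - 1) \<otimes>\<^bsub>M\<^esub> a [^]\<^bsub>M\<^esub> (n - 1)))"

definition aperiodic_element :: "('a, 'b) monoid_scheme \<Rightarrow> 'a \<Rightarrow> bool" where
  "aperiodic_element M x \<longleftrightarrow> (\<exists>k::nat. x [^]\<^bsub>M\<^esub> Suc k = x [^]\<^bsub>M\<^esub> k)"

definition burnside_aperiodic :: "nat \<Rightarrow> ('a, 'b) monoid_scheme \<Rightarrow> bool" where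
  "burnside_aperiodic n M \<longleftrightarrow> (\<forall>a\<in>carrier M. \<forall>b\<in>carrier M. \<forall>c\<in>carrier M.
     aperiodic_element M (burnside_word n M a b c))"

lemma burnside_word_closed:
  assumes "monoid M" "a \<in> carrier M" "b \<in> carrier M" "c \<in> carrier M"
  shows "burnside_word n M a b c \<in> carrier M"
proof -
  interpret monoid M by fact
  show ?thesis using assms by (simp add: burnside_word_def)
qed

lemma burnside_word_eq_one:
  fixes M (structure)
  assumes M: "M \<in> monoids_pow_eq_one n" and n: "n \<ge> 1"
    and [simp]: "a \<in> carrier M" "b \<in> carrier M" "c \<in> carrier M"
  shows "burnside_word n M a b c = \<one>\<^bsub>M\<^esub>"
proof -
  interpret monoid M using M by (simp add: monoids_pow_eq_one_def finite_monoids_def)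
  have exp: "x [^] n = \<one>" if "x \<in> carrier M" for x
    using M that by (simp add: monoids_pow_eq_one_def)
  have l: "x [^] (n - 1) \<otimes> x = \<one>" if "x \<in> carrier M" for x
    using exp[OF that] n nat_pow_Suc[of x "n - 1"] by simp
  have r: "x \<otimes> x [^] (n - 1) = \<one>" if "x \<in> carrier M" for x
    using exp[OF that] n nat_pow_Suc2[OF that, of "n - 1"] by simp
  have "(a \<otimes> b) \<otimes> (b [^] (n - 1) \<otimes> a [^] (n - 1))
      = a \<otimes> ((b \<otimes> b [^] (n - 1)) \<otimes> a [^] (n - 1))"
    by (simp only: m_assoc m_closed nat_pow_closed assms)
  then have ab: "(a \<otimes> b) \<otimes> (b [^] (n - 1) \<otimes> a [^] (n - 1)) = \<one>"
    using r[of a] r[of b] by simp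
  \<comment> \<open>The left side is a left inverse of \<open>ab\<close> and the right side a right
    inverse, so they agree. The word then has the form \<open>y^(n-1) y\<close> with
    \<open>y = c (ab)^(n-1)\<close>.\<close>
  have "(a \<otimes> b) [^] (n - 1) = b [^] (n - 1) \<otimes> a [^] (n - 1)"
    by (rule inv_unique[OF l ab]) simp_all
  then show ?thesis
    using l[of "c \<otimes> (a \<otimes> b) [^] (n - 1)"] by (simp add: burnside_word_def)
qed

lemma hom_nat_pow_monoid:
  assumes "monoid M" "h \<in> hom M N" "h \<one>\<^bsub>M\<^esub> = \<one>\<^bsub>N\<^esub>" "x \<in> carrier M"
  shows "h (x [^]\<^bsub>M\<^esub> (k::nat)) = h x [^]\<^bsub>N\<^esub> k"
proof (induction k)
  case 0
  then show ?case using assms by (simp add: nat_pow_def)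
next
  case (Suc k)
  have "h (x [^]\<^bsub>M\<^esub> Suc k) = h (x [^]\<^bsub>M\<^esub> k) \<otimes>\<^bsub>N\<^esub> h x"
    using assms by (simp add: monoid.nat_pow_Suc monoid.nat_pow_closed hom_mult)
  also have "\<dots> = h x [^]\<^bsub>N\<^esub> Suc k"
    unfolding Suc by (simp add: nat_pow_def)
  finally show ?case .
qed

lemma hom_burnside_word:
  assumes M: "monoid M" and h: "h \<in> hom M N" "h \<one>\<^bsub>M\<^esub> = \<one>\<^bsub>N\<^esub>"
    and "a \<in> carrier M" "b \<in> carrier M" "c \<in> carrier M"
  shows "h (burnside_word n M a b c) = burnside_word n N (h a) (h b) (h c)"
proof -
  interpret monoid M by fact
  show ?thesis
    using assms by (simp add: burnside_word_def hom_mult[OF h(1)] hom_nat_pow_monoid[OF M h])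
qed

section \<open>Closure properties of the class defined by the word\<close>

lemma aperiodic_element_hom:
  assumes "monoid M" "h \<in> hom M N" "h \<one>\<^bsub>M\<^esub> = \<one>\<^bsub>N\<^esub>" "x \<in> carrier M"
    and "aperiodic_element M x"
  shows "aperiodic_element N (h x)"
  using assms unfolding aperiodic_element_def by (metis hom_nat_pow_monoid)

lemma aperiodic_element_inj:
  assumes M: "monoid M" and h: "h \<in> hom M N" "h \<one>\<^bsub>M\<^esub> = \<one>\<^bsub>N\<^esub>" and x: "x \<in> carrier M"
    and inj: "inj_on h (carrier M)" and "aperiodic_element N (h x)"
  shows "aperiodic_element M x"
proof -
  obtain k :: nat where "h x [^]\<^bsub>N\<^esub> Suc k = h x [^]\<^bsub>N\<^esub> k"
    using assms by (auto simp: aperiodic_element_def)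
  then have "h (x [^]\<^bsub>M\<^esub> Suc k) = h (x [^]\<^bsub>M\<^esub> k)"
    by (simp only: hom_nat_pow_monoid[OF M h x])
  then have "x [^]\<^bsub>M\<^esub> Suc k = x [^]\<^bsub>M\<^esub> k"
    by (rule inj_onD[OF inj]) (use M x in \<open>simp_all only: monoid.nat_pow_closed\<close>)
  then show ?thesis unfolding aperiodic_element_def by blast
qed

text \<open>Serves both for submonoids, by inclusion, and for isomorphic copies.\<close>

lemma burnside_aperiodic_inj:
  assumes M: "monoid M" and h: "h \<in> hom M N" "h \<one>\<^bsub>M\<^esub> = \<one>\<^bsub>N\<^esub>"
    and "inj_on h (carrier M)" "burnside_aperiodic n N"
  shows "burnside_aperiodic n M"
  unfolding burnside_aperiodic_def
proof (intro ballI)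
  fix a b c assume abc: "a \<in> carrier M" "b \<in> carrier M" "c \<in> carrier M"
  have "aperiodic_element N (h (burnside_word n M a b c))"
    using assms(5) abc h(1)[unfolded hom_def]
    by (simp add: burnside_aperiodic_def hom_burnside_word[OF M h abc] Pi_iff)
  with assms abc show "aperiodic_element M (burnside_word n M a b c)"
    by (blast intro: aperiodic_element_inj burnside_word_closed)
qed

text \<open>Membership in \<open>hom\<close> does not ask for preservation of the identity. If
  \<open>h x\<close> is the identity of \<open>N\<close>, then
  \<open>h 1 = h x h 1 = h (x 1) = h x\<close>.\<close>

lemma epi_preserves_one:
  assumes "monoid M" "monoid N" "h \<in> epi M N"
  shows "h \<one>\<^bsub>M\<^esub> = \<one>\<^bsub>N\<^esub>"
proof -
  interpret M: monoid M by fact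
  interpret N: monoid N by fact
  have "\<one>\<^bsub>N\<^esub> \<in> h ` carrier M"
    using assms(3) by (simp add: epi_def)
  then obtain x where x: "x \<in> carrier M" "h x = \<one>\<^bsub>N\<^esub>"
    by (metis imageE)
  have h: "h \<in> hom M N" using assms(3) by (simp add: epi_def)
  have "h \<one>\<^bsub>M\<^esub> \<in> carrier N" using h by (auto simp: hom_def)
  then have "h \<one>\<^bsub>M\<^esub> = h x \<otimes>\<^bsub>N\<^esub> h \<one>\<^bsub>M\<^esub>" using x by simp
  also have "\<dots> = h x" using hom_mult[OF h x(1) M.one_closed] x by simp
  finally show ?thesis using x by simp
qed

lemma iso_preserves_one:
  assumes "monoid M" "monoid N" "h \<in> iso M N"
  shows "h \<one>\<^bsub>M\<^esub> = \<one>\<^bsub>N\<^esub>"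
  using assms by (intro epi_preserves_one) (auto simp: iso_iff_mon_epi)

lemma burnside_aperiodic_iso:
  assumes "monoid M" "monoid N" "M \<cong> N" "burnside_aperiodic n N"
  shows "burnside_aperiodic n M"
proof -
  obtain h where h: "h \<in> iso M N" using assms(3) by (auto simp: is_iso_def)
  then show ?thesis
    using assms iso_preserves_one[OF assms(1,2) h]
    by (intro burnside_aperiodic_inj[of M h N]) (simp_all add: iso_def bij_betw_def)
qed

lemma burnside_aperiodic_epi:
  assumes M: "monoid M" and N: "monoid N" and h: "h \<in> epi M N" and ap: "burnside_aperiodic n M"
  shows "burnside_aperiodic n N"
  unfolding burnside_aperiodic_def
proof (intro ballI)
  fix a b c assume "a \<in> carrier N" "b \<in> carrier N" "c \<in> carrier N"
  then obtain a' b' c' where *: "a' \<in> carrier M" "b' \<in> carrier M" "c' \<in> carrier M"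
    "a = h a'" "b = h b'" "c = h c'"
    using h unfolding epi_def by blast
  have h': "h \<in> hom M N" "h \<one>\<^bsub>M\<^esub> = \<one>\<^bsub>N\<^esub>"
    using h epi_preserves_one[OF M N h] by (auto simp: epi_def)
  have "aperiodic_element N (h (burnside_word n M a' b' c'))"
    using ap * by (intro aperiodic_element_hom[OF M h'])
      (auto simp: burnside_aperiodic_def burnside_word_closed[OF M])
  then show "aperiodic_element N (burnside_word n N a b c)"
    using * by (simp add: hom_burnside_word[OF M h'])
qed

text \<open>Allows the stabilisation exponents of the two components in a direct product to be
  replaced by their maximum.\<close>

lemma nat_pow_eq_if_ge:
  assumes "monoid M" "x \<in> carrier M" "x [^]\<^bsub>M\<^esub> Suc k = x [^]\<^bsub>M\<^esub> (k::nat)" "m \<ge> k"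
  shows "x [^]\<^bsub>M\<^esub> m = x [^]\<^bsub>M\<^esub> k"
  using assms(4)
proof (induction m rule: dec_induct)
  case base
  show ?case ..
next
  case (step m)
  then show ?case using assms(3) by (simp add: monoid.nat_pow_Suc[OF assms(1)])
qed

lemma fst_hom_DirProd: "fst \<in> hom (M \<times>\<times> N) M"
  and snd_hom_DirProd: "snd \<in> hom (M \<times>\<times> N) N"
  by (auto simp: hom_def DirProd_def)

lemma nat_pow_DirProd_fst_snd:
  assumes "monoid M" "monoid N" "p \<in> carrier (M \<times>\<times> N)"
  shows "p [^]\<^bsub>M \<times>\<times> N\<^esub> (k::nat) = (fst p [^]\<^bsub>M\<^esub> k, snd p [^]\<^bsub>N\<^esub> k)"
  using hom_nat_pow_monoid[OF DirProd_monoid[OF assms(1,2)] fst_hom_DirProd _ assms(3)]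
    hom_nat_pow_monoid[OF DirProd_monoid[OF assms(1,2)] snd_hom_DirProd _ assms(3)]
  by (simp add: prod_eq_iff)

lemma burnside_aperiodic_DirProd:
  assumes M: "monoid M" and N: "monoid N"
    and "burnside_aperiodic n M" "burnside_aperiodic n N"
  shows "burnside_aperiodic n (M \<times>\<times> N)"
  unfolding burnside_aperiodic_def
proof (intro ballI)
  let ?P = "M \<times>\<times> N"
  fix a b c assume abc: "a \<in> carrier ?P" "b \<in> carrier ?P" "c \<in> carrier ?P"
  define w where "w = burnside_word n ?P a b c"
  have P: "monoid ?P" using M N by (rule DirProd_monoid)
  have w: "w \<in> carrier ?P" using P abc by (simp add: w_def burnside_word_closed del: carrier_DirProd)
  have "aperiodic_element M (fst w)"
    using assms(3) abc hom_burnside_word[OF P fst_hom_DirProd _ abc]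
    by (auto simp: burnside_aperiodic_def w_def)
  then obtain j :: nat where j: "fst w [^]\<^bsub>M\<^esub> Suc j = fst w [^]\<^bsub>M\<^esub> j"
    by (auto simp: aperiodic_element_def)
  have "aperiodic_element N (snd w)"
    using assms(4) abc hom_burnside_word[OF P snd_hom_DirProd _ abc]
    by (auto simp: burnside_aperiodic_def w_def)
  then obtain k :: nat where k: "snd w [^]\<^bsub>N\<^esub> Suc k = snd w [^]\<^bsub>N\<^esub> k"
    by (auto simp: aperiodic_element_def)
  have w': "fst w \<in> carrier M" "snd w \<in> carrier N" using w by auto
  have "w [^]\<^bsub>?P\<^esub> Suc (max j k) = w [^]\<^bsub>?P\<^esub> max j k"
    unfolding nat_pow_DirProd_fst_snd[OF M N w]
    using nat_pow_eq_if_ge[OF M w'(1) j, of "max j k"] nat_pow_eq_if_ge[OF M w'(1) j, of "Suc (max j k)"]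
      nat_pow_eq_if_ge[OF N w'(2) k, of "max j k"] nat_pow_eq_if_ge[OF N w'(2) k, of "Suc (max j k)"]
    by simp
  then show "aperiodic_element ?P (burnside_word n ?P a b c)"
    unfolding aperiodic_element_def w_def by blast
qed

text \<open>A generated pseudovariety is an intersection, so every pseudovariety that contains the
  generators bounds it from above.\<close>

lemma monoid_pseudovariety_burnside_aperiodic:
  assumes "n \<ge> 1"
  shows "monoid_pseudovariety {M \<in> finite_monoids. burnside_aperiodic n M}"
  unfolding monoid_pseudovariety_def
proof (intro conjI ballI allI impI)
  fix M H assume M: "M \<in> {M \<in> finite_monoids. burnside_aperiodic n M}" and H: "submonoid H M"
  have "M\<lparr>carrier := H\<rparr> \<in> finite_monoids"
    using monoid_pseudovariety_finite_monoids M H by (auto simp: monoid_pseudovariety_def)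
  moreover from this have "burnside_aperiodic n (M\<lparr>carrier := H\<rparr>)"
    using M submonoid.subset[OF H]
    by (intro burnside_aperiodic_inj[of "M\<lparr>carrier := H\<rparr>" id M])
      (auto simp: finite_monoids_def hom_def)
  ultimately show "M\<lparr>carrier := H\<rparr> \<in> {M \<in> finite_monoids. burnside_aperiodic n M}" by simp
next
  fix M N assume "M \<in> {M \<in> finite_monoids. burnside_aperiodic n M}" "N \<in> finite_monoids"
    "epi M N \<noteq> {}"
  then show "N \<in> {M \<in> finite_monoids. burnside_aperiodic n M}"
    using burnside_aperiodic_epi[of M N] by (auto simp: finite_monoids_def)
next
  fix M :: "nat monoid" assume M: "M \<in> finite_monoids" "card (carrier M) = 1"
  then interpret monoid M by (simp add: finite_monoids_def)
  have "burnside_aperiodic n M"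
    using M(2) burnside_word_closed[OF monoid_axioms]
    unfolding burnside_aperiodic_def aperiodic_element_def
    by (metis card_1_singletonE nat_pow_closed singletonD)
  then show "M \<in> {M \<in> finite_monoids. burnside_aperiodic n M}" using M by simp
next
  fix M N P :: "nat monoid"
  assume "M \<in> {M \<in> finite_monoids. burnside_aperiodic n M}"
    "N \<in> {M \<in> finite_monoids. burnside_aperiodic n M}" "P \<in> finite_monoids" "P \<cong> M \<times>\<times> N"
  then show "P \<in> {M \<in> finite_monoids. burnside_aperiodic n M}"
    using burnside_aperiodic_iso[of P "M \<times>\<times> N"] burnside_aperiodic_DirProd[of M N]
    by (simp add: finite_monoids_def DirProd_monoid)
qed auto

section \<open>Aperiodic and J-trivial semigroups\<close>

lemma sg_pow_Suc_sgrp_of: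
  assumes "monoid M" "x \<in> carrier M"
  shows "sg_pow_Suc (sgrp_of M X) x k = x [^]\<^bsub>M\<^esub> Suc k"
proof (induction k)
  case 0
  then show ?case using assms by (simp add: sg_pow_Suc_def monoid.nat_pow_Suc monoid.l_one)
next
  case (Suc k)
  then show ?case
    using assms(1) by (simp add: sg_pow_Suc_def sgrp_of_def monoid.nat_pow_Suc)
qed

lemma aperiodic_element_if_aperiodic_semigroup:
  assumes "monoid M" "X \<subseteq> carrier M" "sgrp_of M X \<in> aperiodic_semigroups" "x \<in> X"
  shows "aperiodic_element M x"
proof -
  obtain k where "sg_pow_Suc (sgrp_of M X) x (Suc k) = sg_pow_Suc (sgrp_of M X) x k"
    using assms(3,4) by (auto simp: aperiodic_semigroups_def sgrp_of_def)
  \<comment> \<open>Index \<open>k\<close> in the semigroup is exponent \<open>Suc k\<close> in the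
    monoid, which is the witness.\<close>
  then show ?thesis
    using assms unfolding aperiodic_element_def by (metis sg_pow_Suc_sgrp_of subsetD)
qed

lemma sg_pow_Suc_closed:
  assumes "S \<in> finite_semigroups" "x \<in> carrier S"
  shows "sg_pow_Suc S x k \<in> carrier S"
  using assms by (induction k) (auto simp: sg_pow_Suc_def finite_semigroups_def)

text \<open>Indices are one below exponents: \<open>Suc (j + k)\<close> stands for the exponent (j +
  1) + (k + 1).\<close>

lemma sg_pow_Suc_add:
  assumes "S \<in> finite_semigroups" "x \<in> carrier S"
  shows "sg_pow_Suc S x (Suc (j + k)) = sg_pow_Suc S x j \<odot>\<^bsub>S\<^esub> sg_pow_Suc S x k"
proof (induction k)
  case 0
  show ?case by (simp add: sg_pow_Suc_def)
next
  case (Suc k)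
  have "sg_pow_Suc S x (Suc (j + Suc k)) = sg_pow_Suc S x (Suc (j + k)) \<odot>\<^bsub>S\<^esub> x"
    by (simp add: sg_pow_Suc_def)
  also have "\<dots> = sg_pow_Suc S x j \<odot>\<^bsub>S\<^esub> (sg_pow_Suc S x k \<odot>\<^bsub>S\<^esub> x)"
    using assms sg_pow_Suc_closed[OF assms] unfolding Suc by (simp add: finite_semigroups_def)
  finally show ?case by (simp add: sg_pow_Suc_def)
qed

lemma principal_ideal_right_mult_subset:
  assumes "S \<in> finite_semigroups" "x \<in> carrier S" "y \<in> carrier S"
  shows "principal_ideal S (x \<odot>\<^bsub>S\<^esub> y) \<subseteq> principal_ideal S x"
proof -
  have closed: "\<And>u v. u \<in> carrier S \<Longrightarrow> v \<in> carrier S \<Longrightarrow> u \<odot>\<^bsub>S\<^esub> v \<in> carrier S"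
    and assoc: "\<And>u v w. u \<in> carrier S \<Longrightarrow> v \<in> carrier S \<Longrightarrow> w \<in> carrier S
      \<Longrightarrow> u \<odot>\<^bsub>S\<^esub> v \<odot>\<^bsub>S\<^esub> w = u \<odot>\<^bsub>S\<^esub> (v \<odot>\<^bsub>S\<^esub> w)"
    using assms(1) by (auto simp: finite_semigroups_def)
  show ?thesis
  proof
    fix z assume "z \<in> principal_ideal S (x \<odot>\<^bsub>S\<^esub> y)"
    then consider "z = x \<odot>\<^bsub>S\<^esub> y"
      | a where "a \<in> carrier S" "z = (a \<odot>\<^bsub>S\<^esub> x) \<odot>\<^bsub>S\<^esub> y"
      | b where "b \<in> carrier S" "z = x \<odot>\<^bsub>S\<^esub> (y \<odot>\<^bsub>S\<^esub> b)"
      | a b where "a \<in> carrier S" "b \<in> carrier S" "z = (a \<odot>\<^bsub>S\<^esub> x) \<odot>\<^bsub>S\<^esub> (y \<odot>\<^bsub>S\<^esub> b)"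
      using assms(2,3) by (auto simp: principal_ideal_def assoc closed)
    then show "z \<in> principal_ideal S x"
      using assms(3) closed unfolding principal_ideal_def by cases blast+
  qed
qed

text \<open>The principal ideals of the powers of x decrease. By finiteness some power recurs, so
  the ideals from its first occurrence to the next are equal, and J-triviality makes the first two
  of these powers equal.\<close>

lemma J_trivial_semigroups_subset_aperiodic: "J_trivial_semigroups \<subseteq> aperiodic_semigroups"
proof
  fix S assume "S \<in> J_trivial_semigroups"
  then have S: "S \<in> finite_semigroups" and J: "green_J S \<subseteq> Id"
    by (auto simp: J_trivial_semigroups_def)
  have "\<exists>k. sg_pow_Suc S x (Suc k) = sg_pow_Suc S x k" if x: "x \<in> carrier S" for x
  proof -
    note closed = sg_pow_Suc_closed[OF S x]
    have "finite (range (sg_pow_Suc S x))"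
      using closed S by (auto simp: finite_semigroups_def intro: finite_subset)
    then have "\<not> inj (sg_pow_Suc S x)" using finite_imageD by blast
    then obtain i j where "i < j" and eq: "sg_pow_Suc S x i = sg_pow_Suc S x j"
      unfolding inj_def by (metis nat_neq_iff)
    then obtain p where p: "j = Suc (i + p)" using less_imp_Suc_add by blast
    have sub: "principal_ideal S (sg_pow_Suc S x (Suc (m + k))) \<subseteq> principal_ideal S (sg_pow_Suc S x m)"
      for m k
      unfolding sg_pow_Suc_add[OF S x] by (intro principal_ideal_right_mult_subset S closed)
    \<comment> \<open>The power with index \<open>i\<close> recurs at index \<open>j\<close>, and
      \<open>j\<close> is at least \<open>Suc i\<close>.\<close>
    have "principal_ideal S (sg_pow_Suc S x i) \<subseteq> principal_ideal S (sg_pow_Suc S x (Suc i))"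
    proof (cases p)
      case 0
      then show ?thesis using eq p by simp
    next
      case (Suc r)
      then show ?thesis using sub[of "Suc i" r] eq p by simp
    qed
    then have "(sg_pow_Suc S x (Suc i), sg_pow_Suc S x i) \<in> green_J S"
      using sub[of i 0] closed by (auto simp: green_J_def)
    then show ?thesis using J by blast
  qed
  then show "S \<in> aperiodic_semigroups" using S by (simp add: aperiodic_semigroups_def)
qed

section \<open>Members of the Mal'cev and semidirect products\<close>

lemma malcev_product_burnside_aperiodic:
  assumes n: "n \<ge> 1" and M: "M \<in> aperiodic_semigroups \<circ>\<^sub>M monoids_pow_eq_one n"
  shows "burnside_aperiodic n M"
  unfolding burnside_aperiodic_def
proof (intro ballI)
  fix a b c assume abc: "a \<in> carrier M" "b \<in> carrier M" "c \<in> carrier M"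
  obtain N \<mu> where M': "monoid M" and N: "N \<in> monoids_pow_eq_one n"
    and \<mu>: "submonoid \<mu> (M \<times>\<times> N)" "fst ` \<mu> = carrier M"
    and ap: "\<And>e. e \<in> carrier N \<Longrightarrow> e \<otimes>\<^bsub>N\<^esub> e = e \<Longrightarrow> sgrp_of M {s. (s, e) \<in> \<mu>} \<in> aperiodic_semigroups"
    using M by (auto simp: malcev_product_def relational_morphism_def finite_monoids_def)
  have N': "monoid N" using N by (simp add: monoids_pow_eq_one_def finite_monoids_def)
  let ?P = "M \<times>\<times> N"
  have P: "monoid ?P" using M' N' by (rule DirProd_monoid)
  obtain a' b' c' where in\<mu>: "(a, a') \<in> \<mu>" "(b, b') \<in> \<mu>" "(c, c') \<in> \<mu>"
    using abc unfolding \<mu>(2)[symmetric] by auto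
  have inP: "p \<in> carrier ?P" if "p \<in> \<mu>" for p using submonoid.subset[OF \<mu>(1)] that by blast
  have sub: "monoid (?P\<lparr>carrier := \<mu>\<rparr>)" by (rule submonoid.submonoid_is_monoid[OF \<mu>(1) P])
  \<comment> \<open>Evaluating the word on lifts inside the submonoid \<mu> keeps the value in
    \<mu>. Its projection to \<open>N\<close> is the identity, so its projection to \<open>M\<close>
    lies in the preimage of an idempotent.\<close>
  have "burnside_word n (?P\<lparr>carrier := \<mu>\<rparr>) (a, a') (b, b') (c, c') \<in> \<mu>"
    using burnside_word_closed[OF sub] in\<mu> by simp
  moreover have "fst (burnside_word n (?P\<lparr>carrier := \<mu>\<rparr>) (a, a') (b, b') (c, c')) = burnside_word n M a b c"
    using in\<mu> inP by (subst hom_burnside_word[OF sub, of fst M])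
      (auto simp: hom_def DirProd_def)
  moreover have "snd (burnside_word n (?P\<lparr>carrier := \<mu>\<rparr>) (a, a') (b, b') (c, c')) = burnside_word n N a' b' c'"
    using in\<mu> inP by (subst hom_burnside_word[OF sub, of snd N])
      (auto simp: hom_def DirProd_def)
  moreover have "burnside_word n N a' b' c' = \<one>\<^bsub>N\<^esub>"
    using inP[OF in\<mu>(1)] inP[OF in\<mu>(2)] inP[OF in\<mu>(3)] by (intro burnside_word_eq_one[OF N n]) auto
  ultimately have "burnside_word n M a b c \<in> {s. (s, \<one>\<^bsub>N\<^esub>) \<in> \<mu>}"
    by (metis mem_Collect_eq prod.collapse)
  then show "aperiodic_element M (burnside_word n M a b c)"
    using inP ap[of "\<one>\<^bsub>N\<^esub>"] N'
    by (intro aperiodic_element_if_aperiodic_semigroup[OF M', of "{s. (s, \<one>\<^bsub>N\<^esub>) \<in> \<mu>}"])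
      (auto simp: monoid.one_closed monoid.l_one)
qed

text \<open>The word has trivial \<open>T\<close>-component. Since the identity of \<open>T\<close>
  acts trivially, the elements over it form a copy of \<open>S\<close>, which is aperiodic.\<close>

lemma semidirect_burnside_aperiodic:
  assumes n: "n \<ge> 1" and S: "S \<in> J_trivial_monoids" and T: "T \<in> monoids_pow_eq_one n"
    and \<alpha>: "left_action T S \<alpha>"
  shows "burnside_aperiodic n (semidirect S T \<alpha>)"
  unfolding burnside_aperiodic_def
proof (intro ballI)
  let ?P = "semidirect S T \<alpha>"
  have S': "monoid S" and T': "monoid T"
    using S T by (auto simp: J_trivial_monoids_def monoids_pow_eq_one_def finite_monoids_def)
  have P: "monoid ?P" by (rule semidirect_monoid[OF S' T' \<alpha>])
  fix a b c assume abc: "a \<in> carrier ?P" "b \<in> carrier ?P" "c \<in> carrier ?P"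
  define w where "w = burnside_word n ?P a b c"
  have "snd w = burnside_word n T (snd a) (snd b) (snd c)"
    unfolding w_def using abc by (intro hom_burnside_word[OF P]) (auto simp: hom_def semidirect_def)
  also have "\<dots> = \<one>\<^bsub>T\<^esub>"
    using abc by (intro burnside_word_eq_one[OF T n]) (auto simp: semidirect_def)
  finally obtain s where w: "w = (s, \<one>\<^bsub>T\<^esub>)" by (cases w) auto
  have s: "s \<in> carrier S"
    using burnside_word_closed[OF P abc, of n] w by (auto simp: w_def semidirect_def)
  have ap: "aperiodic_element S s"
    using S s J_trivial_semigroups_subset_aperiodic
    by (intro aperiodic_element_if_aperiodic_semigroup[OF S', of "carrier S"])
      (auto simp: J_trivial_monoids_def)
  have hom: "(\<lambda>s. (s, \<one>\<^bsub>T\<^esub>)) \<in> hom S ?P"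
    using \<alpha> T' by (auto simp: hom_def semidirect_def left_action_def monoid.one_closed monoid.l_one)
  show "aperiodic_element ?P w"
    unfolding w by (rule aperiodic_element_hom[OF S' hom _ s ap]) (simp add: semidirect_def)
qed

lemma semidirect_product_burnside_aperiodic:
  assumes n: "n \<ge> 1" and M: "M \<in> J_trivial_monoids \<^bold>* monoids_pow_eq_one n"
  shows "burnside_aperiodic n M"
proof -
  have "{M \<in> finite_monoids. \<exists>S\<in>J_trivial_monoids. \<exists>T\<in>monoids_pow_eq_one n. \<exists>\<alpha>.
          left_action T S \<alpha> \<and> M \<cong> semidirect S T \<alpha>}
        \<subseteq> {M \<in> finite_monoids. burnside_aperiodic n M}"
    (is "?C \<subseteq> _")
  proof
    fix M assume "M \<in> ?C"
    then obtain S T \<alpha> where M: "M \<in> finite_monoids" "M \<cong> semidirect S T \<alpha>"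
      and ST: "S \<in> J_trivial_monoids" "T \<in> monoids_pow_eq_one n" "left_action T S \<alpha>"
      by blast
    have "monoid (semidirect S T \<alpha>)"
      using ST by (intro semidirect_monoid)
        (auto simp: finite_monoids_def J_trivial_monoids_def monoids_pow_eq_one_def)
    then show "M \<in> {M \<in> finite_monoids. burnside_aperiodic n M}"
      using M semidirect_burnside_aperiodic[OF n ST] burnside_aperiodic_iso[OF _ _ M(2)]
      by (simp add: finite_monoids_def)
  qed
  then show ?thesis
    using M monoid_pseudovariety_burnside_aperiodic[OF n]
    unfolding semidirect_product_def generated_pseudovariety_def by blast
qed

section \<open>Powers in the cyclic word\<close>

text \<open>Letters and offsets keep the form \<open>1\<close> instead of being rewritten to
  \<open>Suc 0\<close>.\<close>

declare One_nat_def [simp del]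

text \<open>
  The letter of \<open>w\<^sup>\<infinity>\<close> at position \<open>t\<close>, with \<open>a, b, c\<close> coded as \<open>0, 1, 2\<close>: the word \<open>w\<close> consists of \<open>n\<close>
  blocks of length \<open>2n - 1\<close>, and the last one is \<open>c b\<^sup>n\<^sup>-\<^sup>1 a\<^sup>n\<^sup>-\<^sup>1\<close> instead of \<open>c(ab)\<^sup>n\<^sup>-\<^sup>1\<close>.
\<close>

definition cycle_label :: "nat \<Rightarrow> nat \<Rightarrow> nat" where
  "cycle_label n t = (let d = 2 * n - 1; r = t mod d in
     if r = 0 then 2
     else if t div d mod n = n - 1 then (if r < n then 1 else 0)
     else (if odd r then 0 else 1))"

text \<open>With a position split into block number and offset, later computations of labels avoid
  division.\<close>

lemma cycle_label_block:
  assumes "r < 2 * n - 1"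
  shows "cycle_label n (q * (2 * n - 1) + r) =
    (if r = 0 then 2
     else if q mod n = n - 1 then (if r < n then 1 else 0)
     else (if odd r then 0 else 1))"
proof -
  have "(q * (2 * n - 1) + r) mod (2 * n - 1) = r" "(q * (2 * n - 1) + r) div (2 * n - 1) = q"
    using assms by simp_all
  then show ?thesis by (simp add: cycle_label_def Let_def)
qed

lemma cycle_label_eq_2_iff: "cycle_label n t = 2 \<longleftrightarrow> (2 * n - 1) dvd t"
  by (simp add: cycle_label_def Let_def mod_eq_0_iff_dvd)

lemma cycle_label_mod:
  assumes "t mod (n * (2 * n - 1)) = t' mod (n * (2 * n - 1))"
  shows "cycle_label n t = cycle_label n t'"
proof (cases "n = 0")
  case False
  define d where "d = 2 * n - 1"
  have d: "d > 0" using False by (simp add: d_def)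
  have *: "s mod d = s mod (n * d) mod d" "s div d mod n = s mod (n * d) div d" for s
    using d mod_mult2_eq[of s d n] by (simp_all add: mult.commute mod_mod_cancel)
  have "t mod d = t' mod d" "t div d mod n = t' div d mod n"
    using assms *[of t] *[of t'] unfolding d_def[symmetric] by simp_all
  then show ?thesis by (simp add: cycle_label_def d_def[symmetric] Let_def)
\<comment> \<open>For \<open>n = 0\<close> the modulus is 0, and the hypothesis says that
  \<open>t = t'\<close>.\<close>
qed (use assms in simp)

lemma ex_mod_eq_in_window:
  fixes u m r :: nat
  assumes "r < m"
  obtains t where "u \<le> t" "t < u + m" "t mod m = r"
proof -
  \<comment> \<open>The distance from \<open>u\<close> to the next position in the class of
    \<open>r\<close>; \<open>r - u mod m\<close> could be truncated.\<close>
  define s where "s = (r + (m - u mod m)) mod m"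
  have "(u + s) mod m = (u mod m + (r + (m - u mod m))) mod m"
    unfolding s_def by (metis mod_add_left_eq mod_add_right_eq)
  also have "u mod m + (r + (m - u mod m)) = r + m"
    using assms mod_less_divisor[of m u] by linarith
  finally have "(u + s) mod m = r" using assms by simp
  then show ?thesis using that[of "u + s"] assms by (simp add: s_def)
qed

text \<open>Ordinary blocks begin with \<open>ca\<close> and the last one with \<open>cb\<close>, so
  the factor \<open>cb\<close> marks a single position modulo the length of w.\<close>

lemma cycle_label_eq_1_iff:
  assumes n: "n \<ge> 2" and t: "t mod (2 * n - 1) = 1"
  shows "cycle_label n t = 1 \<longleftrightarrow> t mod (n * (2 * n - 1)) = (n - 1) * (2 * n - 1) + 1"
proof -
  define d where "d = 2 * n - 1"
  have d: "d > 0" using n by (simp add: d_def)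
  have "t mod (n * d) = d * (t div d mod n) + 1"
    using mod_mult2_eq[of t d n] t by (simp add: d_def mult.commute)
  then have "t mod (n * d) = (n - 1) * d + 1 \<longleftrightarrow> t div d mod n = n - 1"
    using d by (auto simp: mult.commute)
  then show ?thesis using t n by (simp add: cycle_label_def Let_def d_def)
qed

text \<open>A window without c lies among the 2n - 2 other letters of one block, which forces
  \<open>L = 1\<close> and a run of n equal letters. But ordinary blocks alternate, and in the last
  block the runs have length n - 1.\<close>

lemma cycle_label_period_meets_2:
  assumes n: "n \<ge> 2" and L: "L > 0"
    and per: "\<And>i. i < (n - 1) * L \<Longrightarrow> cycle_label n (u + i) = cycle_label n (u + i + L)"
  shows "\<exists>t. u \<le> t \<and> t < u + n * L \<and> (2 * n - 1) dvd t"
proof (rule ccontr)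
  assume no: "\<not> ?thesis"
  define d where "d = 2 * n - 1"
  have d: "d \<ge> 3" using n by (simp add: d_def)
  define q r where "q = u div d" and "r = u mod d"
  have u: "u = q * d + r" by (simp add: q_def r_def)
  have r: "r < d" using d by (simp add: r_def)
  have no': "u + n * L \<le> t" if "u \<le> t" "d dvd t" for t
    using no that by (auto simp: d_def not_less)
  have "n * L > 0" using n L by simp
  then have "r > 0" using no'[of u] by (cases "r = 0") (auto simp: u)
  \<comment> \<open>The start of the next block lies outside the window, so the window ends within
    block \<open>q\<close>.\<close>
  have "u + n * L \<le> q * d + d" using r by (intro no') (simp_all add: u)
  then have rL: "r + n * L \<le> d" by (simp add: u)
  then have "n * L < n * 2" using \<open>r > 0\<close> unfolding d_def by linarith
  then have L1: "L = 1" using L by simp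
  then have rn: "r + n \<le> d" using rL by simp
  show False
  proof (cases "q mod n = n - 1")
    case True
    have "cycle_label n (u + i) = cycle_label n u" if "i \<le> n - 1" for i
      using that
    proof (induction i)
      case (Suc i)
      then show ?case using per[of i] L1 by (simp add: Suc_eq_plus1 add.assoc)
    qed simp
    from this[of "n - 1"] have "cycle_label n (q * d + (r + (n - 1))) = cycle_label n (q * d + r)"
      by (simp add: u add.assoc)
    moreover have "r < n" "\<not> r + (n - 1) < n" "r + (n - 1) < 2 * n - 1" "r < 2 * n - 1"
      using \<open>r > 0\<close> rn n unfolding d_def by linarith+
    ultimately show False
      using \<open>r > 0\<close> True cycle_label_block[of "r + (n - 1)" n q] cycle_label_block[of r n q]
      unfolding d_def by (simp del: Nat.add_diff_assoc)
  next
    case False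
    have "cycle_label n (q * d + (r + 1)) = cycle_label n (q * d + r)"
      using per[of 0] n L1 by (simp add: u add.assoc)
    then show False
      using \<open>r > 0\<close> rn n False cycle_label_block[of "r + 1" n q] cycle_label_block[of r n q]
      by (auto simp: d_def split: if_splits)
  qed
qed

text \<open>The hypothesis says that an n-th power of a word of length \<open>L\<close> is read from
  \<open>u\<close>. A shift by \<open>L\<close> matches some c with another c, so block length
  divides \<open>L\<close>. The window is then long enough to contain the b of a factor
  \<open>cb\<close>, and matching it with another such b gives the full period.\<close>

lemma cycle_label_period_dvd:
  assumes n: "n \<ge> 2"
    and per: "\<And>i. i < (n - 1) * L \<Longrightarrow> cycle_label n (u + i) = cycle_label n (u + i + L)"
  shows "n * (2 * n - 1) dvd L"
proof (cases "L = 0")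
  case False
  define d where "d = 2 * n - 1"
  have d: "d \<ge> 3" using n by (simp add: d_def)
  have nL: "n * L = (n - 1) * L + L" using n by (cases n) auto
  have L_le: "L \<le> (n - 1) * L" using n by (cases n) auto
  \<comment> \<open>The partner of \<open>t\<close> lies \<open>L\<close> to the right, or
    \<open>L\<close> to the left if \<open>t\<close> is in the last of the n periods.\<close>
  have shift: "\<exists>t'. cycle_label n t' = cycle_label n t \<and> (t' = t + L \<or> t = t' + L)"
    if "u \<le> t" "t < u + n * L" for t
  proof (cases "t < u + (n - 1) * L")
    case True
    then show ?thesis using per[of "t - u"] that by auto
  next
    case t: False
    then have "u + L \<le> t" using L_le by linarith
    then show ?thesis using per[of "t - L - u"] that nL by (intro exI[of _ "t - L"]) auto
  qed
  obtain t where t: "u \<le> t" "t < u + n * L" "d dvd t"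
    using cycle_label_period_meets_2[OF n _ per] False by (auto simp: d_def)
  obtain t' where "cycle_label n t' = cycle_label n t" and t': "t' = t + L \<or> t = t' + L"
    using shift[OF t(1,2)] by blast
  then have "d dvd t'" using t(3) cycle_label_eq_2_iff[of n] by (metis d_def)
  then have dL: "d dvd L" using t' t(3) by (auto simp: dvd_add_right_iff)
  then have "d \<le> L" using False by (simp add: dvd_imp_le)
  \<comment> \<open>This residue is that of the b in \<open>cb\<close>.\<close>
  have "(n - 1) * d + 1 < n * d" using d n by (cases n) auto
  then obtain s where s: "u \<le> s" "s < u + n * d" "s mod (n * d) = (n - 1) * d + 1"
    using ex_mod_eq_in_window by blast
  have "s mod d = s mod (n * d) mod d" by (simp add: mod_mod_cancel)
  also have "\<dots> = 1" using d unfolding s(3) by simp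
  finally have s1: "s mod d = 1" .
  have "n * d \<le> n * L" using \<open>d \<le> L\<close> by simp
  then have "s < u + n * L" using s(2) by linarith
  then obtain s' where s': "cycle_label n s' = cycle_label n s" "s' = s + L \<or> s = s' + L"
    using shift[OF s(1)] by blast
  have "s' mod d = 1" using s'(2) s1 dL by (auto simp: dvd_def)
  then have "s' mod (n * d) = s mod (n * d)"
    using s1 s(3) s'(1) cycle_label_eq_1_iff[OF n, of s] cycle_label_eq_1_iff[OF n, of s']
    by (simp add: d_def)
  then show ?thesis using s'(2) unfolding d_def[symmetric]
    by (metis add_diff_cancel_left' le_add1 mod_eq_dvd_iff_nat)
qed simp

section \<open>The ordered monoid of paths in the labelled cycle\<close>

text \<open>This is n times the length of w, so that shifting by w has order n.\<close>

definition cycle_length :: "nat \<Rightarrow> nat" where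
  "cycle_length n = n * (n * (2 * n - 1))"

text \<open>The start \<open>u\<close> ranges over all naturals and only the endpoints are reduced,
  so the labels are read without wrapping around.\<close>

definition path_rel :: "nat \<Rightarrow> nat list \<Rightarrow> (nat \<times> nat) set" where
  "path_rel n x = {(u mod cycle_length n, (u + length x) mod cycle_length n) | u.
     \<forall>i<length x. cycle_label n (u + i) = x ! i}"

definition path_monoid :: "nat \<Rightarrow> (nat \<times> nat) set monoid" where
  "path_monoid n = \<lparr>carrier = range (path_rel n), mult = (O), one = path_rel n []\<rparr>"

lemma cycle_label_cong:
  assumes "u mod cycle_length n = u' mod cycle_length n"
  shows "cycle_label n (u + i) = cycle_label n (u' + i)"
proof (rule cycle_label_mod)
  let ?m = "n * (2 * n - 1)"
  have "u mod ?m = u' mod ?m"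
    using arg_cong[OF assms, of "\<lambda>v. v mod ?m"] by (simp add: cycle_length_def mod_mod_cancel)
  then show "(u + i) mod ?m = (u' + i) mod ?m" by (rule mod_add_cong) simp
qed

text \<open>Two paths that meet on the cycle may have different unreduced positions there;
  periodicity of the labels lets the second one be read from the end of the first.\<close>

lemma path_rel_append: "path_rel n (x @ y) = path_rel n x O path_rel n y"
proof (intro equalityI subsetI)
  fix p assume "p \<in> path_rel n (x @ y)"
  then obtain u where p: "p = (u mod cycle_length n, (u + length (x @ y)) mod cycle_length n)"
    and lbl: "\<And>i. i < length (x @ y) \<Longrightarrow> cycle_label n (u + i) = (x @ y) ! i"
    by (auto simp: path_rel_def)
  have "(u mod cycle_length n, (u + length x) mod cycle_length n) \<in> path_rel n x"
    using lbl by (force simp: path_rel_def nth_append)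
  moreover have "((u + length x) mod cycle_length n, (u + length x + length y) mod cycle_length n)
      \<in> path_rel n y"
    using lbl[of "length x + _"] unfolding path_rel_def by (force simp: add.assoc)
  ultimately show "p \<in> path_rel n x O path_rel n y" unfolding p by (auto simp: add.assoc)
next
  fix p assume "p \<in> path_rel n x O path_rel n y"
  then obtain u u' where p: "p = (u mod cycle_length n, (u' + length y) mod cycle_length n)"
    and x: "\<And>i. i < length x \<Longrightarrow> cycle_label n (u + i) = x ! i"
    and y: "\<And>i. i < length y \<Longrightarrow> cycle_label n (u' + i) = y ! i"
    and eq: "(u + length x) mod cycle_length n = u' mod cycle_length n"
    by (auto simp: path_rel_def)
  have "cycle_label n (u + i) = (x @ y) ! i" if "i < length (x @ y)" for i
  proof (cases "i < length x")
    case False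
    then show ?thesis
      using that y[of "i - length x"] cycle_label_cong[OF eq, of "i - length x"]
      by (simp add: nth_append)
  qed (use x in \<open>simp add: nth_append\<close>)
  moreover have "(u' + length y) mod cycle_length n = (u + length (x @ y)) mod cycle_length n"
    using mod_add_cong[OF eq refl, of "length y"] by (simp add: add.assoc)
  ultimately show "p \<in> path_rel n (x @ y)" unfolding p path_rel_def by blast
qed

lemma monoid_path_monoid: "monoid (path_monoid n)"
proof -
  have "path_rel n [] O path_rel n x = path_rel n x" "path_rel n x O path_rel n [] = path_rel n x" for x
    by (simp_all flip: path_rel_append)
  moreover have "path_rel n x O path_rel n y \<in> range (path_rel n)" for x y
    by (simp flip: path_rel_append)
  ultimately show ?thesis
    unfolding path_monoid_def by (intro monoidI) (force simp: O_assoc simp del: relcomp_unfold)+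
qed

lemma finite_path_monoid:
  assumes "n \<ge> 1"
  shows "finite (carrier (path_monoid n))"
proof (rule finite_subset)
  have "cycle_length n > 0" using assms by (simp add: cycle_length_def)
  then show "carrier (path_monoid n) \<subseteq> Pow ({..<cycle_length n} \<times> {..<cycle_length n})"
    by (auto simp: path_monoid_def path_rel_def)
qed simp

text \<open>Gluing the k passes yields a single path from one unreduced start, to which the result
  on periods applies.\<close>

lemma path_rel_pow:
  assumes "(p, q) \<in> path_rel n x [^]\<^bsub>path_monoid n\<^esub> (k::nat)"
  shows "\<exists>u. p = u mod cycle_length n \<and> q = (u + k * length x) mod cycle_length n
    \<and> (\<forall>i<k * length x. cycle_label n (u + i) = x ! (i mod length x))"
  using assms
proof (induction k arbitrary: q)
  case 0
  then show ?case by (auto simp: path_monoid_def path_rel_def nat_pow_def)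
next
  case (Suc k)
  let ?L = "length x"
  obtain r where r: "(p, r) \<in> path_rel n x [^]\<^bsub>path_monoid n\<^esub> k" "(r, q) \<in> path_rel n x"
    using Suc.prems by (auto simp: monoid.nat_pow_Suc[OF monoid_path_monoid] path_monoid_def)
  obtain u where u: "p = u mod cycle_length n" "r = (u + k * ?L) mod cycle_length n"
      "\<And>i. i < k * ?L \<Longrightarrow> cycle_label n (u + i) = x ! (i mod ?L)"
    using Suc.IH[OF r(1)] by blast
  obtain u' where u': "r = u' mod cycle_length n" "q = (u' + ?L) mod cycle_length n"
      "\<And>i. i < ?L \<Longrightarrow> cycle_label n (u' + i) = x ! i"
    using r(2) by (auto simp: path_rel_def)
  have eq: "(u + k * ?L) mod cycle_length n = u' mod cycle_length n" using u u' by simp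
  have "cycle_label n (u + i) = x ! (i mod ?L)" if "i < Suc k * ?L" for i
  proof (cases "i < k * ?L")
    case False
    then obtain j where j: "i = k * ?L + j" by (metis le_add_diff_inverse not_less)
    then have "j < ?L" using that by simp
    then show ?thesis using j u'(3)[of j] cycle_label_cong[OF eq, of j] by (simp add: add.assoc)
  qed (use u in simp)
  moreover have "q = (u + Suc k * ?L) mod cycle_length n"
    using mod_add_cong[OF eq refl, of ?L] u'(2) by (simp add: add_ac)
  ultimately show ?case using u(1) by blast
qed

text \<open>If \<open>x^n\<close> can be read somewhere, the length of w divides that of x. So the
  length of \<open>x^n\<close> is a multiple of the cycle length, and the path closes.\<close>

lemma path_monoid_pow_subset_one:
  assumes n: "n \<ge> 2" and X: "X \<in> carrier (path_monoid n)"
  shows "X [^]\<^bsub>path_monoid n\<^esub> n \<subseteq> \<one>\<^bsub>path_monoid n\<^esub>"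
proof (rule subrelI)
  fix p q assume "(p, q) \<in> X [^]\<^bsub>path_monoid n\<^esub> n"
  moreover obtain x where "X = path_rel n x" using X by (auto simp: path_monoid_def)
  ultimately obtain u where u: "p = u mod cycle_length n" "q = (u + n * length x) mod cycle_length n"
    and lbl: "\<And>i. i < n * length x \<Longrightarrow> cycle_label n (u + i) = x ! (i mod length x)"
    using path_rel_pow by blast
  have "n * length x = (n - 1) * length x + length x" using n by (cases n) auto
  then have "cycle_label n (u + i) = cycle_label n (u + i + length x)" if "i < (n - 1) * length x" for i
    using that lbl[of i] lbl[of "i + length x"] by (simp add: add.assoc)
  then have "n * (2 * n - 1) dvd length x" by (rule cycle_label_period_dvd[OF n])
  then have "cycle_length n dvd n * length x" by (simp add: cycle_length_def)
  then have "q = p" using u by (metis add.right_neutral dvd_eq_mod_eq_0 mod_add_right_eq)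
  then show "(p, q) \<in> \<one>\<^bsub>path_monoid n\<^esub>" using u(1) by (auto simp: path_monoid_def path_rel_def)
qed

section \<open>The word w acts as a rotation\<close>

definition traverses :: "nat \<Rightarrow> (nat \<times> nat) set \<Rightarrow> nat \<Rightarrow> nat \<Rightarrow> bool" where
  "traverses n X u l \<longleftrightarrow> (u mod cycle_length n, (u + l) mod cycle_length n) \<in> X"

lemma traverses_letter: "cycle_label n u = a \<Longrightarrow> traverses n (path_rel n [a]) u 1"
  unfolding traverses_def path_rel_def by (rule CollectI, rule exI[of _ u]) (simp add: One_nat_def)

text \<open>Starts and lengths stay unreduced, so lengths simply add up.\<close>

lemma traverses_mult:
  "traverses n X u l \<Longrightarrow> traverses n Y (u + l) l' \<Longrightarrow>
    traverses n (X \<otimes>\<^bsub>path_monoid n\<^esub> Y) u (l + l')"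
  by (auto simp: traverses_def path_monoid_def add.assoc)

lemma traverses_pow:
  assumes "\<And>i. i < k \<Longrightarrow> traverses n X (u + i * l) l"
  shows "traverses n (X [^]\<^bsub>path_monoid n\<^esub> (k::nat)) u (k * l)"
  using assms
proof (induction k)
  case 0
  then show ?case by (auto simp: traverses_def path_monoid_def path_rel_def nat_pow_def)
next
  case (Suc k)
  then show ?case
    using traverses_mult[of n "X [^]\<^bsub>path_monoid n\<^esub> k" u "k * l" X l]
    by (simp add: monoid.nat_pow_Suc[OF monoid_path_monoid] add.commute)
qed

text \<open>All paths labelled by the same word have the same length.\<close>

lemma path_rel_deterministic:
  assumes "X \<in> carrier (path_monoid n)" "(p, q) \<in> X" "(p, q') \<in> X"
  shows "q = q'"
  using assms by (auto simp: path_monoid_def path_rel_def intro: mod_add_cong)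

lemma traverses_burnside_word:
  assumes n: "n \<ge> 2"
  shows "traverses n
    (burnside_word n (path_monoid n) (path_rel n [0]) (path_rel n [1]) (path_rel n [2]))
    (j * (n * (2 * n - 1))) (n * (2 * n - 1))"
proof -
  let ?M = "path_monoid n"
  let ?A = "path_rel n [0]" and ?B = "path_rel n [1]" and ?C = "path_rel n [2]"
  define d where "d = 2 * n - 1"
  note block = cycle_label_block[of _ n, folded d_def]
  have C: "traverses n ?C (q * d) 1" for q
    using block[of 0 q] n by (intro traverses_letter) (simp add: d_def)
  have ordinary: "traverses n (?C \<otimes>\<^bsub>?M\<^esub> (?A \<otimes>\<^bsub>?M\<^esub> ?B) [^]\<^bsub>?M\<^esub> (n - 1)) (q * d) d"
    if q: "q mod n \<noteq> n - 1" for q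
  proof -
    \<comment> \<open>After the c at offset 0, the i-th factor \<open>ab\<close> starts at offset 1
      + 2i.\<close>
    have "traverses n (?A \<otimes>\<^bsub>?M\<^esub> ?B) (q * d + 1 + i * (1 + 1)) (1 + 1)" if "i < n - 1" for i
    proof (intro traverses_mult traverses_letter)
      show "cycle_label n (q * d + 1 + i * (1 + 1)) = 0"
        using block[of "1 + i * (1 + 1)" q] that q by (simp add: d_def add.assoc)
      show "cycle_label n (q * d + 1 + i * (1 + 1) + 1) = 1"
        using block[of "1 + i * (1 + 1) + 1" q] that q by (simp add: d_def add.assoc)
    qed
    then have AB: "traverses n ((?A \<otimes>\<^bsub>?M\<^esub> ?B) [^]\<^bsub>?M\<^esub> (n - 1)) (q * d + 1) ((n - 1) * (1 + 1))"
      by (rule traverses_pow)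
    have "1 + (n - 1) * (1 + 1) = d" using n by (simp add: d_def)
    with traverses_mult[OF C AB] show ?thesis by (simp only:)
  qed
  have special: "traverses n (?C \<otimes>\<^bsub>?M\<^esub> (?B [^]\<^bsub>?M\<^esub> (n - 1) \<otimes>\<^bsub>?M\<^esub> ?A [^]\<^bsub>?M\<^esub> (n - 1))) (q * d) d"
    if q: "q mod n = n - 1" for q
  proof -
    have "traverses n ?B (q * d + 1 + i * 1) 1" if "i < n - 1" for i
      using block[of "1 + i" q] that q by (intro traverses_letter) (simp add: d_def add.assoc)
    then have B: "traverses n (?B [^]\<^bsub>?M\<^esub> (n - 1)) (q * d + 1) ((n - 1) * 1)"
      by (rule traverses_pow)
    \<comment> \<open>The letters a of the last block begin at offset n = 1 + (n - 1).\<close>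
    have "traverses n ?A (q * d + 1 + (n - 1) * 1 + i * 1) 1" if "i < n - 1" for i
      using block[of "n + i" q] that q n by (intro traverses_letter) (simp add: d_def add.assoc)
    then have A: "traverses n (?A [^]\<^bsub>?M\<^esub> (n - 1)) (q * d + 1 + (n - 1) * 1) ((n - 1) * 1)"
      by (rule traverses_pow)
    have "1 + ((n - 1) * 1 + (n - 1) * 1) = d" using n by (simp add: d_def)
    with traverses_mult[OF C traverses_mult[OF B A]] show ?thesis by simp
  qed
  \<comment> \<open>The j-th copy of w starts at block \<open>j * n\<close>; its first n - 1 blocks
    are ordinary.\<close>
  have "traverses n (?C \<otimes>\<^bsub>?M\<^esub> (?A \<otimes>\<^bsub>?M\<^esub> ?B) [^]\<^bsub>?M\<^esub> (n - 1)) (j * (n * d) + i * d) d"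
    if "i < n - 1" for i
    using ordinary[of "j * n + i"] that n by (simp add: algebra_simps)
  note pow = traverses_pow[of "n - 1", OF this]
  have "j * (n * d) + (n - 1) * d = (j * n + (n - 1)) * d" by (simp add: algebra_simps)
  moreover have "(j * n + (n - 1)) mod n = n - 1"
    using n unfolding mod_mult_self3 by simp
  ultimately have "traverses n (?C \<otimes>\<^bsub>?M\<^esub> (?B [^]\<^bsub>?M\<^esub> (n - 1) \<otimes>\<^bsub>?M\<^esub> ?A [^]\<^bsub>?M\<^esub> (n - 1)))
      (j * (n * d) + (n - 1) * d) d"
    using special by metis
  note traverses_mult[OF pow this]
  moreover have "(n - 1) * d + d = n * d" using n by (cases n) auto
  ultimately show ?thesis by (simp add: burnside_word_def d_def)
qed

text \<open>The k-th power of w moves 0 by k lengths of w, so stabilisation would make k and k + 1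
  congruent modulo n.\<close>

lemma not_burnside_aperiodic_path_monoid:
  assumes n: "n \<ge> 2"
  shows "\<not> burnside_aperiodic n (path_monoid n)"
proof
  let ?M = "path_monoid n" and ?m = "n * (2 * n - 1)"
  let ?w = "burnside_word n ?M (path_rel n [0]) (path_rel n [1]) (path_rel n [2])"
  assume "burnside_aperiodic n ?M"
  then have "aperiodic_element ?M ?w"
    by (auto simp: burnside_aperiodic_def path_monoid_def)
  then obtain k :: nat where k: "?w [^]\<^bsub>?M\<^esub> Suc k = ?w [^]\<^bsub>?M\<^esub> k"
    by (auto simp: aperiodic_element_def)
  have tr: "traverses n (?w [^]\<^bsub>?M\<^esub> i) 0 (i * ?m)" for i :: nat
    using traverses_burnside_word[OF n] by (intro traverses_pow) simp
  have "?w [^]\<^bsub>?M\<^esub> k \<in> carrier ?M"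
    by (intro monoid.nat_pow_closed burnside_word_closed monoid_path_monoid)
      (auto simp: path_monoid_def)
  then have "(k * ?m) mod cycle_length n = (Suc k * ?m) mod cycle_length n"
    using tr[of k] tr[of "Suc k"] unfolding k traverses_def add_0 by (rule path_rel_deterministic)
  then have "(k mod n) * ?m = (Suc k mod n) * ?m"
    by (simp only: cycle_length_def mult_mod_left)
  then have "k mod n = Suc k mod n" using n by simp
  then show False using n by (simp add: mod_Suc split: if_splits)
qed

section \<open>Transport to carriers in the natural numbers and conclusion\<close>

lemma ex_nat_ordered_monoid:
  assumes G: "monoid G" and fin: "finite (carrier G)"
    and po: "partial_order_on (carrier G) r"
    and mono: "\<And>x y z. (x, y) \<in> r \<Longrightarrow> z \<in> carrier G \<Longrightarrow>
      (z \<otimes>\<^bsub>G\<^esub> x, z \<otimes>\<^bsub>G\<^esub> y) \<in> r \<and> (x \<otimes>\<^bsub>G\<^esub> z, y \<otimes>\<^bsub>G\<^esub> z) \<in> r"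
  obtains M h where "M \<in> finite_ordered_monoids" "h \<in> iso G (monoid.truncate M)"
    "ord_rel M = map_prod h h ` r"
proof -
  interpret G: monoid G by fact
  obtain h :: "'a \<Rightarrow> nat" where h: "inj_on h (carrier G)"
    using finite_imp_inj_to_nat_seg[OF fin] by auto
  define g where "g = inv_into (carrier G) h"
  have gh[simp]: "g (h x) = x" if "x \<in> carrier G" for x using h that by (simp add: g_def)
  have r: "x \<in> carrier G" "y \<in> carrier G" if "(x, y) \<in> r" for x y
    using po that by (auto simp: partial_order_on_def preorder_on_def refl_on_def)
  define M where "M = \<lparr>carrier = h ` carrier G, mult = (\<lambda>x y. h (g x \<otimes>\<^bsub>G\<^esub> g y)), one = h \<one>\<^bsub>G\<^esub>,
    ord_rel = map_prod h h ` r\<rparr>"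
  have "monoid M" by (rule monoidI) (auto simp: M_def G.m_assoc)
  moreover have "partial_order_on (carrier M) (ord_rel M)"
    unfolding partial_order_on_def preorder_on_def
  proof (intro conjI)
    show "ord_rel M \<subseteq> carrier M \<times> carrier M" using r by (auto simp: M_def)
    show "refl_on (carrier M) (ord_rel M)"
      using po by (force simp: M_def partial_order_on_def preorder_on_def refl_on_def)
    show "trans (ord_rel M)"
    proof (rule transI)
      fix a b c assume "(a, b) \<in> ord_rel M" "(b, c) \<in> ord_rel M"
      then obtain x y y' z where *: "(x, y) \<in> r" "(y', z) \<in> r" "a = h x" "b = h y" "b = h y'" "c = h z"
        by (auto simp: M_def)
      then have "y = y'" using r h by (metis inj_onD)
      then have "(x, z) \<in> r" using * po unfolding partial_order_on_def preorder_on_def by (blast dest: transD)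
      then show "(a, c) \<in> ord_rel M" using * by (force simp: M_def)
    qed
    show "antisym (ord_rel M)"
    proof (rule antisymI)
      fix a b assume "(a, b) \<in> ord_rel M" "(b, a) \<in> ord_rel M"
      then obtain x y x' y' where *: "(x, y) \<in> r" "(y', x') \<in> r" "a = h x" "b = h y" "b = h y'" "a = h x'"
        by (auto simp: M_def)
      then have "y = y'" "x = x'" using r h by (metis inj_onD)+
      then show "a = b" using * po unfolding partial_order_on_def by (blast dest: antisymD)
    qed
  qed
  moreover have "(z \<otimes>\<^bsub>M\<^esub> x, z \<otimes>\<^bsub>M\<^esub> y) \<in> ord_rel M \<and> (x \<otimes>\<^bsub>M\<^esub> z, y \<otimes>\<^bsub>M\<^esub> z) \<in> ord_rel M"
    if xy: "(x, y) \<in> ord_rel M" and z: "z \<in> carrier M" for x y z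
  proof -
    obtain x' y' z' where *: "(x', y') \<in> r" "z' \<in> carrier G" "x = h x'" "y = h y'" "z = h z'"
      using xy z by (auto simp: M_def)
    then show ?thesis using mono[of x' y' z'] r[of x' y'] by (force simp: M_def)
  qed
  ultimately have "M \<in> finite_ordered_monoids"
    using fin by (auto simp: finite_ordered_monoids_def M_def)
  moreover have "h \<in> iso G (monoid.truncate M)"
    using h by (auto simp: iso_def hom_def bij_betw_def M_def monoid.truncate_def)
  moreover have "ord_rel M = map_prod h h ` r" by (simp add: M_def)
  ultimately show ?thesis by (rule that)
qed

lemma nat_pow_truncate: "x [^]\<^bsub>monoid.truncate M\<^esub> (k::nat) = x [^]\<^bsub>M\<^esub> k"
  by (simp add: nat_pow_def monoid.truncate_def)

lemma monoid_truncate: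
  assumes "monoid M"
  shows "monoid (monoid.truncate M)"
proof -
  interpret monoid M by fact
  show ?thesis by (rule monoidI) (simp_all add: monoid.truncate_def m_assoc)
qed

lemma ex_one_le_pow_not_burnside_aperiodic:
  assumes n: "n \<ge> 2"
  obtains M where "M \<in> ordered_monoids_one_le_pow n" "\<not> burnside_aperiodic n (monoid.truncate M)"
proof -
  let ?G = "path_monoid n"
  \<comment> \<open>Reverse inclusion turns \<open>X^n \<subseteq> 1\<close> into
    \<open>1 \<le> X^n\<close>; it is compatible because composition of relations is
    monotone.\<close>
  define r where "r = {(X, Y). X \<in> carrier ?G \<and> Y \<in> carrier ?G \<and> Y \<subseteq> X}"
  have G: "monoid ?G" by (rule monoid_path_monoid)
  have "partial_order_on (carrier ?G) r"
    by (auto simp: partial_order_on_def preorder_on_def refl_on_def r_def intro: transI antisymI)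
  moreover have "(Z \<otimes>\<^bsub>?G\<^esub> X, Z \<otimes>\<^bsub>?G\<^esub> Y) \<in> r \<and> (X \<otimes>\<^bsub>?G\<^esub> Z, Y \<otimes>\<^bsub>?G\<^esub> Z) \<in> r"
    if "(X, Y) \<in> r" "Z \<in> carrier ?G" for X Y Z
    using that monoid.m_closed[OF G] by (auto simp: r_def path_monoid_def)
  moreover have "finite (carrier ?G)" using n by (intro finite_path_monoid) simp
  ultimately obtain M h where M: "M \<in> finite_ordered_monoids" and h: "h \<in> iso ?G (monoid.truncate M)"
    and ord: "ord_rel M = map_prod h h ` r"
    using ex_nat_ordered_monoid[OF G, of r thesis] by blast
  have T: "monoid (monoid.truncate M)"
    using M monoid_truncate by (auto simp: finite_ordered_monoids_def)
  have h_one: "h \<one>\<^bsub>?G\<^esub> = \<one>\<^bsub>monoid.truncate M\<^esub>" by (rule iso_preserves_one[OF G T h])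
  have hom: "h \<in> hom ?G (monoid.truncate M)" using h by (simp add: iso_def)
  have "(\<one>\<^bsub>M\<^esub>, s [^]\<^bsub>M\<^esub> n) \<in> ord_rel M" if "s \<in> carrier M" for s
  proof -
    obtain X where X: "X \<in> carrier ?G" "s = h X"
      using h \<open>s \<in> carrier M\<close> by (auto simp: iso_def bij_betw_def monoid.truncate_def)
    have "(\<one>\<^bsub>?G\<^esub>, X [^]\<^bsub>?G\<^esub> n) \<in> r"
      using path_monoid_pow_subset_one[OF n X(1)] monoid.nat_pow_closed[OF G X(1)] monoid.one_closed[OF G]
      by (simp add: r_def)
    then have "(h \<one>\<^bsub>?G\<^esub>, h (X [^]\<^bsub>?G\<^esub> n)) \<in> ord_rel M"
      unfolding ord by force
    then show ?thesis
      unfolding hom_nat_pow_monoid[OF G hom h_one X(1)] h_one nat_pow_truncate X(2)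
      by (simp add: monoid.truncate_def)
  qed
  then have "M \<in> ordered_monoids_one_le_pow n" using M by (simp add: ordered_monoids_one_le_pow_def)
  moreover have "\<not> burnside_aperiodic n (monoid.truncate M)"
    using not_burnside_aperiodic_path_monoid[OF n] burnside_aperiodic_iso[OF G T] h
    by (auto simp: is_iso_def)
  ultimately show ?thesis by (rule that)
qed

theorem corollary5p7:
  fixes n :: nat
  assumes "n \<ge> 2"
  shows "\<not> ordered_monoids_one_le_pow n
           \<subseteq> all_orders (aperiodic_semigroups \<circ>\<^sub>M monoids_pow_eq_one n)
       \<and> \<not> ordered_monoids_one_le_pow n
           \<subseteq> all_orders (J_trivial_semigroups \<circ>\<^sub>M monoids_pow_eq_one n)
       \<and> \<not> ordered_monoids_one_le_pow n
           \<subseteq> all_orders (J_trivial_monoids \<^bold>* monoids_pow_eq_one n)"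
proof -
  obtain M where M: "M \<in> ordered_monoids_one_le_pow n" "\<not> burnside_aperiodic n (monoid.truncate M)"
    using ex_one_le_pow_not_burnside_aperiodic[OF assms] .
  have n: "n \<ge> 1" using assms by simp
  \<comment> \<open>By this inclusion the same \<open>M\<close> refutes all three
    containments.\<close>
  have "J_trivial_semigroups \<circ>\<^sub>M monoids_pow_eq_one n \<subseteq> aperiodic_semigroups \<circ>\<^sub>M monoids_pow_eq_one n"
    using J_trivial_semigroups_subset_aperiodic unfolding malcev_product_def by blast
  then show ?thesis
    using M malcev_product_burnside_aperiodic[OF n] semidirect_product_burnside_aperiodic[OF n]
    unfolding all_orders_def by blast
qed

end
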